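(* For all barriers $B$, $\mathsf{TS}^B\leq_{\mathrm{sW}}\mathsf{FS}^B$.
   Context: $\mathbb{N}$ is the set of natural numbers (including $0$). Subsets of $\mathbb{N}$ are identified with their strictly increasing enumerations; $s\sqsubset Y$ means that $s$ is a proper initial segment of $Y$ as a sequence; $\subset$ is strict set inclusion. A set $B$ of finite subsets of $\mathbb{N}$ is a barrier on an infinite set $X\subseteq\mathbb{N}$ if: (1) $\bigcup B=X$; (2) for all $s,t\in B$, $s\not\subset t$; (3) for every infinite $Y\subseteq X$ there is $s\in B$ with $s\sqsubset Y$. The set $X=\bigcup B$ is the base of $B$. For infinite $Y\subseteq X$, $B\vert Y=\{s\in B: s\subseteq Y\}$ (this is a barrier on $Y$, and every barrier $B'\subseteq B$ has this form). $\mathsf{TS}^B$ is the problem whose instances are the functions $f:B\to\mathbb{N}$, where a solution to $f$ is an infinite $Y$ contained in the base of $B$ such that $f(B\vert Y)\neq\mathbb{N}$. $\mathsf{FS}^B$ is the problem whose instances are the functions $f:B\to\mathbb{N}$, where a solution to $f$ is an infinite $Y$ contained in the base of $B$ such that for all $s\in B\vert Y$, if $f(s)\in Y$ then $f(s)\in s$. Instances and solutions are coded as subsets of $\mathbb{N}$ in a standard way, a coloring being given together with its domain (so that the barrier is uniformly computable from a coloring of it). For such problems $\mathsf{P},\mathsf{Q}$, $\mathsf{Q}\leq_{\mathrm{sW}}\mathsf{P}$ (strong Weihrauch reducibility) means: there are Turing functionals $\Phi,\Psi$ such that for every instance $I$ of $\mathsf{Q}$, $\Phi(I)$ is an instance of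 $\mathsf{P}$, and for every solution $\hat Y$ to $\Phi(I)$, $\Psi(\hat Y)$ is a solution to $I$ for $\mathsf{Q}$. *)

theory Defs
  imports Main "HOL-Library.Infinite_Set" "HOL-Library.FuncSet" "HOL-Library.Nat_Bijection"
begin

section \<open>Turing functionals\<close>

text \<open>
  Indices of Turing functionals are programs for Kleene's partial recursive functions relative to
  an oracle. A program run on an argument list of the wrong length diverges.
\<close>

datatype oprog =
    Zero
  | Succ
  | Proj nat
  | Oracle
  | Comp oprog "oprog list"
  | PrimRec oprog oprog
  | Mu oprog

primrec run :: "oprog \<Rightarrow> nat set \<Rightarrow> nat list \<Rightarrow> nat option" where
  "run Zero A xs = Some 0"
| "run Succ A xs = (case xs of [x] \<Rightarrow> Some (Suc x) | _ \<Rightarrow> None)"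
| "run (Proj i) A xs = (if i < length xs then Some (xs ! i) else None)"
| "run Oracle A xs = (case xs of [x] \<Rightarrow> Some (if x \<in> A then 1 else 0) | _ \<Rightarrow> None)"
| "run (Comp f gs) A xs = Option.bind (those (map (\<lambda>g. run g A xs) gs)) (run f A)"
| "run (PrimRec f g) A xs =
    (case xs of
       [] \<Rightarrow> None
     | n # ys \<Rightarrow>
         rec_nat (run f A ys) (\<lambda>m r. Option.bind r (\<lambda>y. run g A (m # y # ys))) n)"
| "run (Mu f) A xs =
    (if \<exists>n. run f A (n # xs) = Some 0 \<and> (\<forall>m<n. run f A (m # xs) \<noteq> None)
     then Some (LEAST n. run f A (n # xs) = Some 0)
     else None)"

text \<open>
  The functional with index \<open>p\<close> is defined at \<open>A\<close> with value \<open>C\<close> if, with oracle \<open>A\<close>, it computes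
  the characteristic function of \<open>C\<close>. There is at most one such \<open>C\<close>.
\<close>

definition functional_value :: "oprog \<Rightarrow> nat set \<Rightarrow> nat set \<Rightarrow> bool" where
  "functional_value p A C \<longleftrightarrow> (\<forall>n. run p A [n] = Some (if n \<in> C then 1 else 0))"

lemma functional_value_unique:
  assumes "functional_value p A C" and "functional_value p A D"
  shows "C = D"
proof (rule set_eqI)
  fix n
  have "(if n \<in> C then 1 else 0 :: nat) = (if n \<in> D then 1 else 0)"
    using assms[unfolded functional_value_def, rule_format, of n] by simp
  then show "n \<in> C \<longleftrightarrow> n \<in> D"
    by (simp split: if_splits)
qed


section \<open>Problems and strong Weihrauch reducibility\<close>

record problem =
  instances :: "nat set set"
  solutions :: "nat set \<Rightarrow> nat set set"

definition sW_reducible :: "problem \<Rightarrow> problem \<Rightarrow> bool" (infix \<open>\<le>\<^sub>s\<^sub>W\<close> 50) where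
  "Q \<le>\<^sub>s\<^sub>W P \<longleftrightarrow>
    (\<exists>\<Phi> \<Psi>. \<forall>I \<in> instances Q.
       \<exists>J. functional_value \<Phi> I J \<and> J \<in> instances P \<and>
         (\<forall>Z \<in> solutions P J. \<exists>Y. functional_value \<Psi> Z Y \<and> Y \<in> solutions Q I))"


section \<open>Barriers\<close>

text \<open>
  The increasing enumeration of the finite set \<open>s\<close> is an initial segment of that of \<open>Y\<close>; it is
  then automatically proper. Only meaningful for infinite \<open>Y\<close>.
\<close>

definition initial_segment :: "nat set \<Rightarrow> nat set \<Rightarrow> bool" (infix \<open>\<sqsubset>\<close> 50) where
  "s \<sqsubset> Y \<longleftrightarrow> finite s \<and> sorted_list_of_set s = map (enumerate Y) [0..<card s]"

definition barrier_on :: "nat set set \<Rightarrow> nat set \<Rightarrow> bool" where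
  "barrier_on B X \<longleftrightarrow>
    infinite X \<and>
    (\<forall>s\<in>B. finite s) \<and>
    \<Union>B = X \<and>
    (\<forall>s\<in>B. \<forall>t\<in>B. \<not> s \<subset> t) \<and>
    (\<forall>Y. infinite Y \<and> Y \<subseteq> X \<longrightarrow> (\<exists>s\<in>B. s \<sqsubset> Y))"

definition barrier :: "nat set set \<Rightarrow> bool" where
  "barrier B \<longleftrightarrow> (\<exists>X. barrier_on B X)"

definition base :: "nat set set \<Rightarrow> nat set" where
  "base B = \<Union>B"

definition restr :: "nat set set \<Rightarrow> nat set \<Rightarrow> nat set set" (infixl \<open>\<restriction>\<close> 70) where
  "B \<restriction> Y = {s \<in> B. s \<subseteq> Y}"


section \<open>The problems TS and FS\<close>

text \<open>
  The code of a coloring \<open>f\<close> of \<open>B\<close> is the join of (the code of) its domain with (that of) its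
  graph, finite sets being coded by their canonical indices. The graph alone would make \<open>B\<close> only
  computably enumerable, not computable, in the code.
\<close>

definition coloring_code :: "nat set set \<Rightarrow> (nat set \<Rightarrow> nat) \<Rightarrow> nat set" where
  "coloring_code B f =
    {sum_encode (Inl (set_encode s)) | s. s \<in> B} \<union>
    {sum_encode (Inr (prod_encode (set_encode s, f s))) | s. s \<in> B}"

definition coloring_problem ::
    "nat set set \<Rightarrow> ((nat set \<Rightarrow> nat) \<Rightarrow> nat set \<Rightarrow> bool) \<Rightarrow> problem" where
  "coloring_problem B S =
    \<lparr> instances = {coloring_code B f | f. f \<in> B \<rightarrow>\<^sub>E UNIV},
      solutions = (\<lambda>I. {Y. \<exists>f \<in> B \<rightarrow>\<^sub>E UNIV. I = coloring_code B f \<and>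
                            infinite Y \<and> Y \<subseteq> base B \<and> S f Y}) \<rparr>"

definition TS :: "nat set set \<Rightarrow> problem" where
  "TS B = coloring_problem B (\<lambda>f Y. f ` (B \<restriction> Y) \<noteq> UNIV)"

definition FS :: "nat set set \<Rightarrow> problem" where
  "FS B = coloring_problem B (\<lambda>f Y. \<forall>s \<in> B \<restriction> Y. f s \<in> Y \<longrightarrow> f s \<in> s)"

text \<open>
  Codes determine colorings, so the existential quantifier over \<open>f\<close> in the definition of the
  solutions ranges over the one coloring coded by \<open>I\<close>.
\<close>

lemma coloring_code_inj:
  assumes "\<forall>s\<in>B. finite s"
  shows "inj_on (coloring_code B) (B \<rightarrow>\<^sub>E UNIV)"
proof (rule inj_onI)
  fix f g :: "nat set \<Rightarrow> nat"
  assume f: "f \<in> B \<rightarrow>\<^sub>E UNIV" and g: "g \<in> B \<rightarrow>\<^sub>E UNIV"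
    and eq: "coloring_code B f = coloring_code B g"
  show "f = g"
  proof (rule PiE_ext[OF f g])
    fix s assume s: "s \<in> B"
    then have "sum_encode (Inr (prod_encode (set_encode s, f s))) \<in> coloring_code B g"
      unfolding eq[symmetric] by (auto simp: coloring_code_def)
    then obtain t where "t \<in> B" "set_encode s = set_encode t" "f s = g t"
      by (auto simp: coloring_code_def sum_encode_eq)
    moreover from this have "s = t"
      using assms s by (simp add: set_encode_eq)
    ultimately show "f s = g s" by simp
  qed
qed

lemma solutions_coloring_code:
  assumes "\<forall>s\<in>B. finite s" and "f \<in> B \<rightarrow>\<^sub>E UNIV"
  shows "Y \<in> solutions (coloring_problem B S) (coloring_code B f) \<longleftrightarrow>
    infinite Y \<and> Y \<subseteq> base B \<and> S f Y"
proof -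
  have "g = f" if "g \<in> B \<rightarrow>\<^sub>E UNIV" "coloring_code B f = coloring_code B g" for g
    using inj_onD[OF coloring_code_inj[OF assms(1)] that(2) assms(2) that(1)] by simp
  then show ?thesis
    using assms(2) unfolding coloring_problem_def by (simp; blast)
qed

end

(* An infinite set Y free for f loses a colour as soon as it loses a point: if s avoids min Y but
   is contained in Y, then f s = min Y would contradict freeness. So the identity and
   Y \<mapsto> Y - {min Y} witness the reduction. *)
theory Submission
  imports Defs
begin

lemma functional_value_Oracle: "functional_value Oracle A A"
  by (simp add: functional_value_def)

text \<open>A bounded search by recursion. The inner \<open>PrimRec\<close> is a case split on the
  value so far, \<open>Proj 1\<close>: at 0 the oracle is asked about the counter,
  \<open>Proj 0\<close>; at a positive value the result is 1.\<close>

definition exists_below_prog :: oprog where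
  "exists_below_prog =
    PrimRec Zero (Comp (PrimRec Oracle (Comp Succ [Zero])) [Proj 1, Proj 0])"

lemma run_exists_below_prog:
  "run exists_below_prog A [n] = Some (if \<exists>m<n. m \<in> A then 1 else 0)"
  by (induction n) (auto simp: exists_below_prog_def less_Suc_eq)

text \<open>\<open>PrimRec\<close> acts as a conditional on the oracle's answer at the input
  \<open>n\<close>: answer 0 returns 0, and answer 1 runs one step on the arguments 0, 0,
  \<open>n\<close>, so \<open>Proj 2\<close> recovers \<open>n\<close>.\<close>

definition remove_min_prog :: oprog where
  "remove_min_prog =
    Comp (PrimRec Zero (Comp exists_below_prog [Proj 2])) [Oracle, Proj 0]"

lemma functional_value_remove_min:
  assumes "A \<noteq> {}"
  shows "functional_value remove_min_prog A (A - {LEAST n. n \<in> A})"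
proof -
  \<comment> \<open>An element of \<open>A\<close> differs from the minimum iff \<open>A\<close> has
    a smaller element, so a search below \<open>n\<close> decides membership.\<close>
  have "n \<in> A - {LEAST n. n \<in> A} \<longleftrightarrow> n \<in> A \<and> (\<exists>m<n. m \<in> A)" for n
    using assms LeastI_ex[of "\<lambda>n. n \<in> A"] Least_le[of "\<lambda>n. n \<in> A" n]
    by (auto simp: order_le_less dest: not_less_Least)
  then show ?thesis
    by (simp add: functional_value_def remove_min_prog_def run_exists_below_prog)
qed

text \<open>The removed point is itself the missed colour. Any \<open>a\<close> in \<open>Y\<close>
  will do; the minimum is a choice that one program can make uniformly.\<close>

lemma TS_solution_if_FS_solution:
  assumes "Y \<in> solutions (FS B) I" and "a \<in> Y"
  shows "Y - {a} \<in> solutions (TS B) I"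
proof -
  obtain f where f: "f \<in> B \<rightarrow>\<^sub>E UNIV" "I = coloring_code B f"
    and Y: "infinite Y" "Y \<subseteq> base B"
    and free: "\<forall>s \<in> B \<restriction> Y. f s \<in> Y \<longrightarrow> f s \<in> s"
    using assms(1) by (auto simp: FS_def coloring_problem_def)
  have "a \<notin> f ` (B \<restriction> (Y - {a}))"
    using free assms(2) by (auto simp: restr_def)
  then have "f ` (B \<restriction> (Y - {a})) \<noteq> UNIV"
    by blast
  moreover have "infinite (Y - {a})" "Y - {a} \<subseteq> base B"
    using Y by auto
  ultimately show ?thesis
    using f by (auto simp: TS_def coloring_problem_def)
qed

theorem theorem8:
  fixes B :: "nat set set"
  assumes "barrier B"
  shows "TS B \<le>\<^sub>s\<^sub>W FS B"
  unfolding sW_reducible_def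
proof (intro exI ballI conjI)
  fix I assume I: "I \<in> instances (TS B)"
  show "functional_value Oracle I I"
    by (rule functional_value_Oracle)
  show "I \<in> instances (FS B)"
    \<comment> \<open>The instances of \<open>coloring_problem B S\<close> do not depend on
      \<open>S\<close>.\<close>
    using I by (simp add: TS_def FS_def coloring_problem_def)
  fix Z assume Z: "Z \<in> solutions (FS B) I"
  then have "Z \<noteq> {}"
    by (auto simp: FS_def coloring_problem_def)
  then show "functional_value remove_min_prog Z (Z - {LEAST n. n \<in> Z})"
    by (rule functional_value_remove_min)
  have "(LEAST n. n \<in> Z) \<in> Z"
    using \<open>Z \<noteq> {}\<close> by (auto intro: LeastI)
  with Z show "Z - {LEAST n. n \<in> Z} \<in> solutions (TS B) I"
    by (rule TS_solution_if_FS_solution)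
qed

end
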